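(* For every real $\lambda$ with $0<\lambda<1$, there exists a class of sparse node-weighted graphs (an infinite family of graphs $G$, with $n\to\infty$ nodes and $O(n)$ edges, each equipped with positive node weights and an initial two-coloring) such that, under Switching Rule II with parameter $\lambda$, the minority process on these graphs has stabilization time $2^{\Theta(n)}$ in the Sequential Adversarial model $SA$.
   Context: Let $G=(V,E)$ be a simple undirected graph with $n$ nodes and a positive node-weight function $w:V\to\mathbb{R}^+$. For $S\subseteq V$ write $W_S=\sum_{u\in S}w(u)$, and let $N(v)$ denote the neighborhood of $v$. A coloring is a map $C:V\to\{\text{black},\text{white}\}$. Under a coloring, $N_S(v)=\{u\in N(v): C(u)=C(v)\}$ and $N_O(v)=N(v)\setminus N_S(v)$. Switching Rule II (proportional switching) with parameter $\lambda\in(0,1)$: a node $v$ is switchable if $W_{N_S(v)}-W_{N_O(v)}\ge \lambda\cdot W_{N(v)}$; switching $v$ means changing its color to the other color. A minority process is a sequence of colorings (states) $S_0,S_1,\dots$, where $S_0$ is the given initial coloring and each $S_i$ is obtained from $S_{i-1}$ by switching some nodes that are switchable in $S_{i-1}$. A state is stable if it has no switchable node; the stabilization time is the number of steps until a stable state is reached. In model $SA$ (Sequential Adversarial), exactly one switchable node switches in each step, chosen by an adversarial player who aims to maximize the stabilization time; thus the stabilization time in $SA$ is the maximum number of steps over all such valid sequential runs until a stable state is reached. *)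

theory Defs
  imports Complex_Main "HOL-Library.Extended_Nat" "HOL-Library.Landau_Symbols"
    "Graph_Theory.Pair_Digraph"
begin

text \<open>
  A simple undirected graph is a \<^locale>\<open>pair_graph\<close>: finite, loop-free, with a symmetric set of
  arcs. Each undirected edge is a pair of opposite arcs; \<open>edges\<close> counts it once.
\<close>

definition edges :: "'a pair_pre_digraph \<Rightarrow> 'a set set" where
  "edges G = {{u, v} | u v. (u, v) \<in> parcs G}"

definition nbhd :: "'a pair_pre_digraph \<Rightarrow> 'a \<Rightarrow> 'a set" where
  "nbhd G v = {u. (v, u) \<in> parcs G}"

datatype color = Black | White

fun other_color :: "color \<Rightarrow> color" where
  "other_color Black = White"
| "other_color White = Black"

text \<open>
  A coloring is a total function on the vertex type; its values outside the vertex set are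
  irrelevant and never change.
\<close>

type_synonym 'a coloring = "'a \<Rightarrow> color"

definition nbhd_same :: "'a pair_pre_digraph \<Rightarrow> 'a coloring \<Rightarrow> 'a \<Rightarrow> 'a set" where
  "nbhd_same G C v = {u \<in> nbhd G v. C u = C v}"

definition nbhd_opp :: "'a pair_pre_digraph \<Rightarrow> 'a coloring \<Rightarrow> 'a \<Rightarrow> 'a set" where
  "nbhd_opp G C v = nbhd G v - nbhd_same G C v"

definition switchable ::
  "real \<Rightarrow> 'a pair_pre_digraph \<Rightarrow> ('a \<Rightarrow> real) \<Rightarrow> 'a coloring \<Rightarrow> 'a \<Rightarrow> bool" where
  "switchable lam G w C v \<longleftrightarrow>
     v \<in> pverts G \<and>
     sum w (nbhd_same G C v) - sum w (nbhd_opp G C v) \<ge> lam * sum w (nbhd G v)"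

definition stable ::
  "real \<Rightarrow> 'a pair_pre_digraph \<Rightarrow> ('a \<Rightarrow> real) \<Rightarrow> 'a coloring \<Rightarrow> bool" where
  "stable lam G w C \<longleftrightarrow> (\<nexists>v. switchable lam G w C v)"

definition sa_step ::
  "real \<Rightarrow> 'a pair_pre_digraph \<Rightarrow> ('a \<Rightarrow> real) \<Rightarrow> 'a coloring \<Rightarrow> 'a coloring \<Rightarrow> bool" where
  "sa_step lam G w C C' \<longleftrightarrow>
     (\<exists>v. switchable lam G w C v \<and> C' = C(v := other_color (C v)))"

text \<open>
  \<open>sa_run lam G w C0 S T\<close>: the states \<open>S 0, S 1, \<dots>\<close> form a sequential process from \<open>C0\<close> which
  makes exactly \<open>T\<close> steps and then is in a stable state, or which never stabilizes, in case
  \<open>T = \<infinity>\<close>. For finite \<open>T\<close> the values of \<open>S\<close> beyond \<open>T\<close> are irrelevant.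
\<close>

definition sa_run ::
  "real \<Rightarrow> 'a pair_pre_digraph \<Rightarrow> ('a \<Rightarrow> real) \<Rightarrow> 'a coloring \<Rightarrow> (nat \<Rightarrow> 'a coloring) \<Rightarrow> enat \<Rightarrow> bool"
where
  "sa_run lam G w C0 S T \<longleftrightarrow>
     S 0 = C0 \<and>
     (\<forall>i. enat i < T \<longrightarrow> sa_step lam G w (S i) (S (Suc i))) \<and>
     (\<forall>t. T = enat t \<longrightarrow> stable lam G w (S t))"

text \<open>
  A finite supremum of extended naturals is attained, so this is the maximal number of steps;
  it is \<open>\<infinity>\<close> if some run never stabilizes.
\<close>

definition stabilization_time_SA ::
  "real \<Rightarrow> 'a pair_pre_digraph \<Rightarrow> ('a \<Rightarrow> real) \<Rightarrow> 'a coloring \<Rightarrow> enat" where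
  "stabilization_time_SA lam G w C0 = Sup {T. \<exists>S. sa_run lam G w C0 S T}"

end

theory Submission
  imports Defs
begin

text \<open>
  The nodes form layers of width \<open>m\<close> whose weights decrease geometrically so fast that a node is
  governed by its neighbours in the preceding layer alone. Inside a block of \<open>m\<close> layers consecutive
  layers are joined by a matching, so a block consists of \<open>m\<close> parallel paths. A node of a path may
  follow its predecessor with a delay of one flip; hence a path stores up to \<open>m - 1\<close> flips of its
  first node and replays them later, at moments chosen by the adversary. Consecutive blocks are
  joined by a complete bipartite graph, and a first node of the next block is switchable as soon as
  all but one of the \<open>m\<close> preceding nodes have its colour. Here \<open>1 / m\<close> is small against \<open>1 - lam\<close>.

  When all paths of a block have stored \<open>m - 1\<close> flips, they are replayed in a staggered way: in every
  round exactly one path is late, each path in turn. A late path sits out two rounds, because after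
  the first of them it has the right colour again. So \<open>m - 1\<close> flips per path give \<open>m + 1\<close>
  alternations of the colour of the almost unanimous majority, and every block multiplies the number
  of flips by about \<open>(m + 1) / (m - 1)\<close>. Conversely, the energy of the coloring decreases strictly
  in every step, so no state repeats and there are at most \<open>2 ^ n\<close> steps.
\<close>

section \<open>Termination and the upper bound\<close>

fun color_sign :: "color \<Rightarrow> real" where
  "color_sign Black = 1"
| "color_sign White = -1"

text \<open>The Ising energy with couplings \<open>w x * w y\<close>. Every undirected edge counts
  twice, once per arc.\<close>

definition energy :: "'a pair_pre_digraph \<Rightarrow> ('a \<Rightarrow> real) \<Rightarrow> 'a coloring \<Rightarrow> real" where
  "energy G w C = (\<Sum>(x, y)\<in>parcs G. w x * w y * (color_sign (C x) * color_sign (C y)))"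

lemma color_sign_mult: "color_sign c * color_sign d = (if c = d then 1 else -1)"
  by (cases c; cases d) auto

lemma eq_other_color_iff: "c = other_color d \<longleftrightarrow> c \<noteq> d"
  by (cases c; cases d) auto

lemma finite_nbhd:
  assumes "pair_graph G"
  shows "finite (nbhd G v)"
proof -
  interpret pair_graph G by fact
  have "nbhd G v \<subseteq> snd ` parcs G" by (force simp: nbhd_def)
  then show ?thesis using pair_finite_arcs finite_subset by blast
qed

text \<open>Separates the arcs at \<open>v\<close>, which occur in both directions. The bracket is
  the quantity that the switching rule compares.\<close>

lemma energy_split:
  assumes "pair_graph G"
  shows "energy G w C =
    (\<Sum>(x, y)\<in>{e \<in> parcs G. fst e \<noteq> v \<and> snd e \<noteq> v}. w x * w y * (color_sign (C x) * color_sign (C y)))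
    + 2 * (w v * (sum w (nbhd_same G C v) - sum w (nbhd_opp G C v)))"
proof -
  interpret pair_graph G by fact
  let ?f = "\<lambda>(x, y). w x * w y * (color_sign (C x) * color_sign (C y))"
  let ?R = "{e \<in> parcs G. fst e \<noteq> v \<and> snd e \<noteq> v}"
  let ?N = "nbhd G v"
  have fin: "finite ?N" using finite_nbhd[OF assms] .
  have finR: "finite ?R" using pair_finite_arcs by simp
  have sym: "(x, y) \<in> parcs G \<Longrightarrow> (y, x) \<in> parcs G" for x y
    using pair_sym_arcs by (auto simp: symmetric_def dest: symD)
  have nl: "v \<notin> ?N" using pair_no_loops by (force simp: nbhd_def)
  have eq: "parcs G = ?R \<union> (Pair v ` ?N \<union> (\<lambda>y. (y, v)) ` ?N)"
    by (force simp: nbhd_def dest: sym)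
  have d1: "?R \<inter> (Pair v ` ?N \<union> (\<lambda>y. (y, v)) ` ?N) = {}" by auto
  have d2: "Pair v ` ?N \<inter> (\<lambda>y. (y, v)) ` ?N = {}" using nl by auto
  have s1: "sum ?f (Pair v ` ?N) = (\<Sum>y\<in>?N. ?f (v, y))"
    by (subst sum.reindex) (auto simp: inj_on_def)
  have s2: "sum ?f ((\<lambda>y. (y, v)) ` ?N) = (\<Sum>y\<in>?N. ?f (v, y))"
    by (subst sum.reindex) (auto simp: inj_on_def ac_simps)
  have same: "nbhd_same G C v \<subseteq> ?N" by (auto simp: nbhd_same_def)
  have "(\<Sum>y\<in>?N. ?f (v, y)) = (\<Sum>y\<in>nbhd_opp G C v. ?f (v, y)) + (\<Sum>y\<in>nbhd_same G C v. ?f (v, y))"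
    unfolding nbhd_opp_def by (rule sum.subset_diff[OF same fin])
  also have "(\<Sum>y\<in>nbhd_same G C v. ?f (v, y)) = w v * sum w (nbhd_same G C v)"
    by (auto simp: sum_distrib_left nbhd_same_def color_sign_mult intro!: sum.cong)
  also have "(\<Sum>y\<in>nbhd_opp G C v. ?f (v, y)) = - (w v * sum w (nbhd_opp G C v))"
    unfolding sum_distrib_left sum_negf[symmetric]
    by (rule sum.cong) (auto simp: nbhd_opp_def nbhd_same_def color_sign_mult)
  finally have h: "(\<Sum>y\<in>?N. ?f (v, y)) = w v * (sum w (nbhd_same G C v) - sum w (nbhd_opp G C v))"
    by (simp add: algebra_simps)
  have "energy G w C = sum ?f (?R \<union> (Pair v ` ?N \<union> (\<lambda>y. (y, v)) ` ?N))"
    unfolding energy_def using eq by simp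
  also have "\<dots> = sum ?f ?R + (sum ?f (Pair v ` ?N) + sum ?f ((\<lambda>y. (y, v)) ` ?N))"
    by (subst sum.union_disjoint[OF finR _ d1], simp add: fin,
        subst sum.union_disjoint[OF _ _ d2], simp_all add: fin)
  finally show ?thesis unfolding s1 s2 h by simp
qed

text \<open>Switching \<open>v\<close> exchanges its like-colored and unlike-colored neighbours and
  so negates the bracket of \<open>energy_split\<close>. That bracket was positive because the
  neighbourhood has positive weight; an isolated node would stay switchable forever.\<close>

lemma energy_decreases:
  assumes G: "pair_graph G"
    and pos: "\<And>v. v \<in> pverts G \<Longrightarrow> 0 < w v"
    and nonisolated: "\<And>v. v \<in> pverts G \<Longrightarrow> nbhd G v \<noteq> {}"
    and lam: "0 < lam"
    and step: "sa_step lam G w C C'"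
  shows "energy G w C' < energy G w C"
proof -
  interpret pair_graph G by fact
  obtain v where v: "switchable lam G w C v" and C': "C' = C(v := other_color (C v))"
    using step by (auto simp: sa_step_def)
  let ?N = "nbhd G v"
  have fin: "finite ?N" using finite_nbhd[OF G] .
  have vV: "v \<in> pverts G" using v by (simp add: switchable_def)
  have nl: "v \<notin> ?N" using pair_no_loops by (force simp: nbhd_def)
  have swap: "nbhd_same G C' v = nbhd_opp G C v" "nbhd_opp G C' v = nbhd_same G C v"
    using nl unfolding nbhd_same_def nbhd_opp_def C'
    by (auto simp: eq_other_color_iff split: if_splits)
  have "0 < sum w ?N"
    using nonisolated[OF vV] fin pos by (intro sum_pos) (auto simp: nbhd_def dest: in_arcsD2)
  then have "0 < lam * sum w ?N" using lam by simp
  then have h: "0 < sum w (nbhd_same G C v) - sum w (nbhd_opp G C v)"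
    using v unfolding switchable_def by linarith
  have R: "(\<Sum>(x, y)\<in>{e \<in> parcs G. fst e \<noteq> v \<and> snd e \<noteq> v}. w x * w y * (color_sign (C' x) * color_sign (C' y)))
      = (\<Sum>(x, y)\<in>{e \<in> parcs G. fst e \<noteq> v \<and> snd e \<noteq> v}. w x * w y * (color_sign (C x) * color_sign (C y)))"
    by (rule sum.cong) (auto simp: C')
  have "energy G w C - energy G w C' = 4 * (w v * (sum w (nbhd_same G C v) - sum w (nbhd_opp G C v)))"
    using energy_split[OF G, of w C v] energy_split[OF G, of w C' v] R swap
    by (simp add: algebra_simps)
  moreover have "0 < w v * (sum w (nbhd_same G C v) - sum w (nbhd_opp G C v))"
    using h pos[OF vV] by simp
  ultimately show ?thesis by simp
qed

text \<open>The energies, hence the states, are pairwise distinct, and a state is determined by its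
  black nodes because colors outside the graph never change. So \<open>n + 1\<close> states inject
  into the subsets of \<open>pverts G\<close>.\<close>

lemma run_length_bound:
  assumes G: "pair_graph G"
    and pos: "\<And>v. v \<in> pverts G \<Longrightarrow> 0 < w v"
    and nonisolated: "\<And>v. v \<in> pverts G \<Longrightarrow> nbhd G v \<noteq> {}"
    and lam: "0 < lam"
    and steps: "\<And>i. i < n \<Longrightarrow> sa_step lam G w (S i) (S (Suc i))"
  shows "n < 2 ^ card (pverts G)"
proof -
  interpret pair_graph G by fact
  let ?black = "\<lambda>i. {v \<in> pverts G. S i v = Black}"
  have dec: "energy G w (S j) < energy G w (S i)" if "i < j" "j \<le> n" for i j
    using that
  proof (induction j)
    case (Suc j)
    have "energy G w (S (Suc j)) < energy G w (S j)"
      using energy_decreases[OF G pos nonisolated lam steps] Suc.prems by simp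
    then show ?case using Suc by (cases "i = j") auto
  qed simp
  have outside: "S i v = S 0 v" if "i \<le> n" "v \<notin> pverts G" for i v
    using that
  proof (induction i)
    case (Suc i)
    then show ?case using steps[of i] by (auto simp: sa_step_def switchable_def)
  qed simp
  have "inj_on ?black {..n}"
  proof (rule linorder_inj_onI)
    fix i j assume ij: "i < j" "i \<in> {..n}" "j \<in> {..n}"
    show "?black i \<noteq> ?black j"
    proof
      assume eq: "?black i = ?black j"
      have "S i v = S j v" for v
      proof (cases "v \<in> pverts G")
        case True
        then have "S i v = Black \<longleftrightarrow> S j v = Black" using eq by blast
        then show ?thesis by (cases "S i v"; cases "S j v") auto
      next
        case False
        then show ?thesis using outside[of i v] outside[of j v] ij by simp
      qed
      then have "S i = S j" by blast
      then show False using dec[of i j] ij by simp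
    qed
  qed auto
  then have "card {..n} \<le> card (Pow (pverts G))"
    by (rule card_inj_on_le) (auto simp: pair_finite_verts)
  then show ?thesis by (simp add: card_Pow pair_finite_verts)
qed

text \<open>A longest sequence of steps from \<open>C0\<close> exists and ends in a stable state, as
  it could otherwise be extended. Thus any \<open>n\<close> steps, stable at the end or not, bound
  the stabilization time from below.\<close>

lemma stabilization_time_SA_bounds:
  assumes G: "pair_graph G"
    and pos: "\<And>v. v \<in> pverts G \<Longrightarrow> 0 < w v"
    and nonisolated: "\<And>v. v \<in> pverts G \<Longrightarrow> nbhd G v \<noteq> {}"
    and lam: "0 < lam"
    and path: "(sa_step lam G w ^^ n) C0 C1"
  shows "\<exists>T. stabilization_time_SA lam G w C0 = enat T \<and> n \<le> T \<and> T \<le> 2 ^ card (pverts G)"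
proof -
  have bound: "t < 2 ^ card (pverts G)" if "\<And>i. i < t \<Longrightarrow> sa_step lam G w (S i) (S (Suc i))" for t S
    by (rule run_length_bound[where w = w and lam = lam and S = S]) (use G pos nonisolated lam that in auto)
  let ?P = "\<lambda>t. \<exists>C. (sa_step lam G w ^^ t) C0 C"
  have le: "t \<le> 2 ^ card (pverts G)" if "?P t" for t
  proof -
    from that obtain S where "\<forall>i<t. sa_step lam G w (S i) (S (Suc i))"
      by (auto simp: relpowp_fun_conv)
    then show ?thesis using bound[of t S] by simp
  qed
  have Pn: "?P n" using path by blast
  define T where "T = (GREATEST t. ?P t)"
  have PT: "?P T" unfolding T_def by (rule GreatestI_nat[of ?P, OF Pn]) (use le in blast)
  have max: "t \<le> T" if "?P t" for t
    unfolding T_def by (rule Greatest_le_nat[of ?P, OF that]) (use le in blast)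
  obtain S where S0: "S 0 = C0" and St: "\<forall>i<T. sa_step lam G w (S i) (S (Suc i))"
    using PT by (auto simp: relpowp_fun_conv)
  have ST: "(sa_step lam G w ^^ T) C0 (S T)" using S0 St by (auto simp: relpowp_fun_conv)
  have "stable lam G w (S T)"
  proof (rule ccontr)
    assume "\<not> stable lam G w (S T)"
    then obtain C where "sa_step lam G w (S T) C" by (auto simp: stable_def sa_step_def)
    then have "?P (Suc T)" using ST by auto
    then show False using max by fastforce
  qed
  then have run: "sa_run lam G w C0 S (enat T)" using S0 St by (simp add: sa_run_def)
  have ub: "t \<le> enat T" if r: "sa_run lam G w C0 S' t" for S' t
  proof (cases t)
    case (enat i)
    then have "\<forall>j<i. sa_step lam G w (S' j) (S' (Suc j))" "S' 0 = C0"
      using r by (auto simp: sa_run_def)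
    then have "?P i" by (auto simp: relpowp_fun_conv)
    then show ?thesis using max enat by simp
  next
    case infinity
    then have "sa_step lam G w (S' i) (S' (Suc i))" for i using r by (simp add: sa_run_def)
    \<comment> \<open>An unending run would contain \<open>2 ^ card (pverts G)\<close> steps, which
      \<open>bound\<close> forbids.\<close>
    then show ?thesis using bound[of "2 ^ card (pverts G)" S'] by simp
  qed
  have "stabilization_time_SA lam G w C0 = enat T"
    unfolding stabilization_time_SA_def
    by (rule antisym) (use run ub in \<open>auto intro: Sup_least Sup_upper\<close>)
  then show ?thesis using max[OF Pn] le[OF PT] by blast
qed

section \<open>The flip counters\<close>

text \<open>
  In the state \<open>(a, u)\<close> the nodes of the first layer of block \<open>k\<close> have flipped \<open>a k\<close> times, and the
  last node of path \<open>i\<close> of block \<open>k\<close> has flipped \<open>u k i\<close> times, so that the path stores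
  \<open>a k - u k i\<close> flips. The counters are normalized so that a node is due to flip iff its counter
  and that of its predecessor differ in parity.
\<close>

definition ready :: "nat \<Rightarrow> nat \<Rightarrow> (nat \<Rightarrow> nat) \<Rightarrow> (nat \<Rightarrow> nat \<Rightarrow> nat) \<Rightarrow> bool" where
  "ready m k a u \<longleftrightarrow>
     (\<forall>i<m. u k i \<le> a k) \<and> (\<exists>q. \<forall>i<m. i \<noteq> q \<longrightarrow> odd (u k i + a (Suc k)))"

type_synonym counters = "(nat \<Rightarrow> nat) \<times> (nat \<Rightarrow> nat \<Rightarrow> nat)"

text \<open>\<open>drain\<close> releases at most one stored flip on each path of block
  \<open>k\<close>, and at least one in all; \<open>load\<close> stores one further flip on every
  path of block \<open>Suc k\<close>. A path holds at most \<open>m - 1\<close> flips. Neither rule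
  changes \<open>a 0\<close>: the first block lives on its initial store.\<close>

inductive counter_step :: "nat \<Rightarrow> nat \<Rightarrow> counters \<Rightarrow> counters \<Rightarrow> bool" for m K where
  drain: "k < K \<Longrightarrow>
     (\<And>i. i < m \<Longrightarrow> a k \<le> u k i + (m - 1) \<and> g i \<le> a k \<and> (g i = u k i \<or> g i = Suc (u k i))) \<Longrightarrow>
     i < m \<Longrightarrow> g i \<noteq> u k i \<Longrightarrow> counter_step m K (a, u) (a, u(k := g))"
| load: "Suc k < K \<Longrightarrow> ready m k a u \<Longrightarrow>
     (\<And>i. i < m \<Longrightarrow> a (Suc k) < u (Suc k) i + (m - 1)) \<Longrightarrow>
     counter_step m K (a, u) (a(Suc k := Suc (a (Suc k))), u)"

text \<open>
  \<open>available m k n s\<close>: the blocks below \<open>k\<close> can trigger \<open>n\<close> flips of the first layer of block \<open>k\<close>.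
  The capacity of block \<open>k\<close> is not taken into account, since the steps of block \<open>k\<close> and of later
  blocks can be interleaved arbitrarily without disturbing the earlier blocks. At least one step is
  required before each flip, so that \<open>n\<close> bounds the number of steps inside the blocks below \<open>k\<close>.
\<close>

inductive available :: "nat \<Rightarrow> nat \<Rightarrow> nat \<Rightarrow> counters \<Rightarrow> bool" for m where
  zero: "available m k 0 s"
| Suc: "(counter_step m (Suc k))\<^sup>+\<^sup>+ (a, u) (a', u') \<Longrightarrow> ready m k a' u' \<Longrightarrow>
     available m (Suc k) n (a'(Suc k := Suc (a' (Suc k))), u') \<Longrightarrow>
     available m (Suc k) (Suc n) (a, u)"

section \<open>Steps of the first blocks are independent of the later blocks\<close>

definition merge :: "nat \<Rightarrow> (nat \<Rightarrow> 'b) \<Rightarrow> (nat \<Rightarrow> 'b) \<Rightarrow> nat \<Rightarrow> 'b" where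
  "merge k f g j = (if j < k then f j else g j)"

lemma counter_step_mono:
  assumes "counter_step m K s t" "K \<le> L"
  shows "counter_step m L s t"
  using assms(1)
proof cases
  case (drain k a u g i)
  then show ?thesis using assms(2) by (auto intro!: counter_step.drain)
next
  case (load k a u)
  then show ?thesis using assms(2) by (auto intro!: counter_step.load)
qed

text \<open>A step inside the first \<open>K\<close> blocks reads and changes only counters with
  index below \<open>K\<close>, so the others can be replaced at will.\<close>

lemma counter_step_local:
  assumes "counter_step m K (a, u) (a', u')"
  shows "counter_step m K (merge K a b, merge K u v) (merge K a' b, merge K u' v)"
  using assms
proof cases
  case (drain k g i)
  have eq: "merge K u' v = (merge K u v)(k := g)"
    using drain by (auto simp: merge_def fun_eq_iff)
  show ?thesis unfolding eq drain(1)
    by (rule counter_step.drain[where i = i]) (use drain in \<open>simp_all add: merge_def\<close>)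
next
  case (load k)
  have eq: "merge K a' b = (merge K a b)(Suc k := Suc (merge K a b (Suc k)))"
    using load by (auto simp: merge_def fun_eq_iff)
  show ?thesis unfolding eq load(2)
    by (rule counter_step.load) (use load in \<open>simp_all add: merge_def ready_def\<close>)
qed

lemma counter_steps_local:
  assumes "(counter_step m K)\<^sup>+\<^sup>+ (a, u) (a', u')"
  shows "(counter_step m K)\<^sup>+\<^sup>+ (merge K a b, merge K u v) (merge K a' b, merge K u' v)"
  using assms
proof (induction "(a', u')" arbitrary: a' u' rule: tranclp_induct)
  case base
  then show ?case using counter_step_local by blast
next
  case (step y)
  obtain a1 u1 where y: "y = (a1, u1)" by force
  show ?case using step y counter_step_local tranclp.trancl_into_trancl by metis
qed

lemma counter_steps_outside:
  assumes "(counter_step m K)\<^sup>*\<^sup>* (a, u) (a', u')" "K \<le> j"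
  shows "a' j = a j \<and> u' j = u j"
  using assms(1)
proof (induction "(a', u')" arbitrary: a' u' rule: rtranclp_induct)
  case (step y)
  obtain a1 u1 where y: "y = (a1, u1)" by force
  have "a' j = a1 j \<and> u' j = u1 j"
    using step(2) assms(2) unfolding y by cases auto
  then show ?case using step y by simp
qed simp

text \<open>Agreement is required at \<open>a k\<close> as well, because \<open>ready\<close> for
  the block before \<open>k\<close> reads the parity of \<open>a k\<close>.\<close>

lemma available_cong:
  assumes "available m k n (a, u)" "\<And>j. j \<le> k \<Longrightarrow> b j = a j" "\<And>j. j < k \<Longrightarrow> v j = u j"
  shows "available m k n (b, v)"
  using assms
proof (induction k n "(a, u)" arbitrary: a u b v rule: available.induct)
  case (zero k)
  then show ?case by (simp add: available.zero)
next
  case (Suc k a u a' u' n)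
  let ?a' = "merge (Suc k) a' b" and ?u' = "merge (Suc k) u' v"
  have "merge (Suc k) a b = b" "merge (Suc k) u v = v"
    using Suc.prems by (auto simp: merge_def fun_eq_iff)
  then have st: "(counter_step m (Suc k))\<^sup>+\<^sup>+ (b, v) (?a', ?u')"
    using counter_steps_local[OF Suc.hyps(1), of b v] by simp
  have "a' (Suc k) = a (Suc k)"
    using counter_steps_outside[OF tranclp_into_rtranclp[OF Suc.hyps(1)], of "Suc k"] by simp
  then have top: "?a' (Suc k) = a' (Suc k)" using Suc.prems(1)[of "Suc k"] by (simp add: merge_def)
  have rd: "ready m k ?a' ?u'"
    using Suc.hyps(2) top by (simp add: ready_def merge_def)
  have "available m (Suc k) n (?a'(Suc k := Suc (?a' (Suc k))), ?u')"
    by (rule Suc.hyps(4)) (use top in \<open>auto simp: merge_def less_Suc_eq_le\<close>)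
  then show ?case using available.Suc[OF st rd] by blast
qed

lemma available_prepend:
  assumes "(counter_step m k)\<^sup>*\<^sup>* s t" "available m k n t"
  shows "available m k n s"
  using assms(2,1)
proof cases
  case zero
  then show ?thesis by (simp add: available.zero)
next
  case (Suc k' a u a' u' n')
  obtain b v where s: "s = (b, v)" by force
  show ?thesis
    using Suc assms(1) unfolding s by (auto intro: available.Suc rtranclp_tranclp_tranclp)
qed

text \<open>Turns \<open>r\<close> of the available flips into actual \<open>load\<close> steps
  while every path of block \<open>k\<close> has room; the other \<open>n\<close> remain
  available.\<close>

lemma available_load:
  assumes "available m k (n + r) (a, u)" "\<And>i. i < m \<Longrightarrow> a k + r \<le> u k i + (m - 1)"
  shows "\<exists>a' u'. (counter_step m (Suc k))\<^sup>*\<^sup>* (a, u) (a', u') \<and> a' k = a k + r \<and> u' k = u k \<and>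
    a' (Suc k) = a (Suc k) \<and> available m k n (a', u')"
  using assms
proof (induction r arbitrary: a u)
  case 0
  then show ?case by auto
next
  case (Suc r)
  have "available m k (Suc (n + r)) (a, u)" using Suc.prems(1) by simp
  then obtain l a1 u1 where k: "k = Suc l"
    and st: "(counter_step m k)\<^sup>+\<^sup>+ (a, u) (a1, u1)" and rd: "ready m l a1 u1"
    and av: "available m k (n + r) (a1(k := Suc (a1 k)), u1)"
    by cases auto
  let ?a1 = "a1(k := Suc (a1 k))"
  have out: "a1 j = a j \<and> u1 j = u j" if "k \<le> j" for j
    using counter_steps_outside[OF tranclp_into_rtranclp[OF st] that] .
  have st1: "(counter_step m (Suc k))\<^sup>*\<^sup>* (a, u) (a1, u1)"
    using tranclp_into_rtranclp[OF st]
    by (rule rtranclp_mono[THEN predicate2D, rotated]) (auto intro: counter_step_mono)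
  have "counter_step m (Suc k) (a1, u1) (?a1, u1)"
    unfolding k using rd Suc.prems(2) out[of k] k by (intro counter_step.load) fastforce+
  then have st2: "(counter_step m (Suc k))\<^sup>*\<^sup>* (a, u) (?a1, u1)"
    using st1 by (rule rtranclp.rtrancl_into_rtrancl[rotated])
  have room: "?a1 k + r \<le> u1 k i + (m - 1)" if "i < m" for i
    using Suc.prems(2)[OF that] out[of k] by simp
  obtain a' u' where "(counter_step m (Suc k))\<^sup>*\<^sup>* (?a1, u1) (a', u')" "a' k = ?a1 k + r" "u' k = u1 k"
    "a' (Suc k) = ?a1 (Suc k)" "available m k n (a', u')"
    using Suc.IH[OF av room] by blast
  then show ?case
    using st2 out[of k] out[of "Suc k"] by (intro exI[of _ a'] exI[of _ u']) auto
qed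

text \<open>The number of flips which path \<open>i\<close> has replayed after round \<open>j\<close>; it is late in round \<open>i + 1\<close>.\<close>

definition stagger :: "nat \<Rightarrow> nat \<Rightarrow> nat" where
  "stagger i j = (if j \<le> i then j else if j = Suc i then i else j - 2)"

lemma stagger_Suc: "stagger i (Suc j) = stagger i j \<or> stagger i (Suc j) = Suc (stagger i j)"
  by (auto simp: stagger_def)

lemma stagger_le: "i < m \<Longrightarrow> j \<le> Suc m \<Longrightarrow> stagger i j \<le> m - 1"
  by (auto simp: stagger_def)

lemma stagger_final: "i < m \<Longrightarrow> stagger i (Suc m) = m - 1"
  by (auto simp: stagger_def)

lemma stagger_parity: "i \<noteq> j \<Longrightarrow> even (stagger i (Suc j) + Suc j)"
  by (auto simp: stagger_def)

text \<open>Makes each round a genuine \<open>drain\<close>. Path \<open>0\<close> moves in every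
  round from \<open>j = 2\<close> on, and path \<open>2\<close> moves before that, which is where
  \<open>3 \<le> m\<close> enters.\<close>

lemma stagger_moves:
  assumes "3 \<le> m"
  shows "\<exists>i<m. stagger i (Suc j) \<noteq> stagger i j"
proof (cases "2 \<le> j")
  case True
  then show ?thesis using assms by (intro exI[of _ 0]) (auto simp: stagger_def)
next
  case False
  then show ?thesis using assms by (intro exI[of _ 2]) (auto simp: stagger_def)
qed

text \<open>Each of the \<open>r\<close> remaining rounds triggers one flip of block
  \<open>Suc k\<close>, and \<open>fin\<close> supplies the \<open>l\<close> flips that follow the
  last round. The \<open>n\<close> flips available for block \<open>k\<close> survive, since a round
  changes only \<open>u k\<close> and \<open>a (Suc k)\<close>, which that availability does not
  read.\<close>

lemma available_drain:
  assumes m: "3 \<le> m"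
    and fin: "\<And>a u. available m k n (a, u) \<Longrightarrow> a k = b + (m - 1) \<Longrightarrow>
      (\<And>i. i < m \<Longrightarrow> u k i = b + (m - 1)) \<Longrightarrow> even (b + Suc m + a (Suc k)) \<Longrightarrow>
      available m (Suc k) l (a, u)"
    and "j + r = Suc m"
    and "available m k n (a, u)" "a k = b + (m - 1)"
    and "\<And>i. i < m \<Longrightarrow> u k i = b + stagger i j" "even (b + j + a (Suc k))"
  shows "available m (Suc k) (r + l) (a, u)"
  using assms(3-)
proof (induction r arbitrary: j a u)
  case 0
  then show ?case using fin[of a u] by (simp add: stagger_final)
next
  case (Suc r)
  let ?g = "\<lambda>i. b + stagger i (Suc j)"
  let ?u = "u(k := ?g)" and ?a = "a(Suc k := Suc (a (Suc k)))"
  obtain i where i: "i < m" "stagger i (Suc j) \<noteq> stagger i j" using stagger_moves[OF m] by blast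
  have st: "counter_step m (Suc k) (a, u) (a, ?u)"
  proof (rule counter_step.drain[OF _ _ i(1)])
    fix i assume "i < m"
    then show "a k \<le> u k i + (m - 1) \<and> ?g i \<le> a k \<and> (?g i = u k i \<or> ?g i = Suc (u k i))"
      using Suc.prems stagger_Suc[of i j] stagger_le[of i m "Suc j"] by auto
  qed (use i Suc.prems in auto)
  \<comment> \<open>Path \<open>j\<close> is the late one in round \<open>Suc j\<close>; for
    \<open>j = m\<close> no path is late.\<close>
  have rd: "ready m k a ?u"
    unfolding ready_def
  proof (intro conjI exI[of _ j] allI impI)
    fix i assume "i < m"
    then show "?u k i \<le> a k" using Suc.prems stagger_le[of i m "Suc j"] by simp
  next
    fix i assume "i < m" "i \<noteq> j"
    then show "odd (?u k i + a (Suc k))"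
      using stagger_parity[of i j] Suc.prems(5) by simp presburger
  qed
  have "available m (Suc k) (r + l) (?a, ?u)"
  proof (rule Suc.IH)
    show "available m k n (?a, ?u)" by (rule available_cong[OF Suc.prems(2)]) auto
  qed (use Suc.prems in auto)
  then show ?case using available.Suc[OF _ rd] st by auto
qed

text \<open>A full block runs through cycles: \<open>m + 1\<close> rounds empty it, then
  \<open>m - 1\<close> flips from the earlier blocks refill it. As \<open>m\<close> is odd,
  \<open>a k\<close> and \<open>a (Suc k)\<close> both grow by even numbers in a cycle, which
  restores the parity hypothesis.\<close>

lemma available_next_level:
  assumes "3 \<le> m" "odd m" "available m k n (a, u)"
    and "\<And>i. i < m \<Longrightarrow> u k i + (m - 1) = a k" "even (a k + a (Suc k))"
  shows "available m (Suc k) (Suc m * Suc (n div (m - 1))) (a, u)"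
  using assms(3-)
proof (induction n arbitrary: a u rule: less_induct)
  case (less n)
  obtain b where b: "a k = b + (m - 1)" using less.prems(2)[of 0] assms(1)
    by (metis less_le_trans zero_less_numeral)
  have u: "u k i = b" if "i < m" for i using less.prems(2)[OF that] b by linarith
  have ev: "even (m - 1)" using assms(2) by simp
  \<comment> \<open>The flips of all cycles after the first, one cycle for each refill by
    \<open>m - 1\<close> flips.\<close>
  define l where "l = Suc m * (n div (m - 1))"
  have "available m (Suc k) (Suc m + l) (a, u)"
  proof (rule available_drain[where j = 0 and b = b, OF assms(1) _ _ less.prems(1) b])
    fix a' u'
    assume av: "available m k n (a', u')" and a': "a' k = b + (m - 1)"
      and u': "\<And>i. i < m \<Longrightarrow> u' k i = b + (m - 1)" and par: "even (b + Suc m + a' (Suc k))"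
    show "available m (Suc k) l (a', u')"
    proof (cases "n < m - 1")
      case True
      then show ?thesis by (simp add: l_def available.zero)
    next
      case False
      then have n: "n = (n - (m - 1)) + (m - 1)" by simp
      obtain a1 u1 where st: "(counter_step m (Suc k))\<^sup>*\<^sup>* (a', u') (a1, u1)"
        and 1: "a1 k = a' k + (m - 1)" "u1 k = u' k" "a1 (Suc k) = a' (Suc k)"
          "available m k (n - (m - 1)) (a1, u1)"
        using available_load[of m k "n - (m - 1)" "m - 1" a' u'] av n a' u' by auto
      have "available m (Suc k) (Suc m * Suc ((n - (m - 1)) div (m - 1))) (a1, u1)"
      proof (rule less.IH)
        show "n - (m - 1) < n" using False assms(1) by simp
        show "even (a1 k + a1 (Suc k))" using 1 a' par ev assms(1) by simp
      qed (use 1 a' u' in auto)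
      moreover have "Suc ((n - (m - 1)) div (m - 1)) = n div (m - 1)"
        using False assms(1) by (simp add: le_div_geq)
      ultimately show ?thesis using available_prepend[OF st] unfolding l_def by metis
    qed
  qed (use less.prems(3) b u ev in \<open>auto simp: stagger_def\<close>)
  then show ?case by (simp add: l_def)
qed

text \<open>A lower bound for how often the blocks below \<open>k\<close> can make the first layer
  of block \<open>k\<close> flip when all paths start full. Nothing precedes block
  \<open>0\<close>.\<close>

fun alternations :: "nat \<Rightarrow> nat \<Rightarrow> nat" where
  "alternations m 0 = 0"
| "alternations m (Suc k) = Suc m * Suc (alternations m k div (m - 1))"

text \<open>Every path starts full and all \<open>a k\<close> are equal, so one and the same state
  meets the hypotheses of \<open>available_next_level\<close> at every level.\<close>

lemma available_alternations:
  assumes "3 \<le> m" "odd m"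
  shows "available m k (alternations m k) (\<lambda>_. m - 1, \<lambda>_ _. 0)"
proof (induction k)
  case (Suc k)
  then show ?case using available_next_level[OF assms Suc] by simp
qed (simp add: available.zero)

section \<open>The layered graph\<close>

text \<open>
  Node \<open>x\<close> lies in layer \<open>x div m\<close> on path \<open>x mod m\<close>; layers \<open>k * m, \<dots>, k * m + m - 1\<close> form block \<open>k\<close>.
\<close>

definition preds :: "nat \<Rightarrow> nat \<Rightarrow> nat set" where
  "preds m x = {y. Suc (y div m) = x div m \<and> (m dvd x div m \<or> y mod m = x mod m)}"

definition ladder :: "nat \<Rightarrow> nat \<Rightarrow> nat pair_pre_digraph" where
  "ladder m K = \<lparr>pverts = {..<K * m * m},
     parcs = {(x, y). x < K * m * m \<and> y < K * m * m \<and> (x \<in> preds m y \<or> y \<in> preds m x)}\<rparr>"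

text \<open>For the weights chosen below and \<open>b\<close> the color of \<open>x\<close>, this
  makes \<open>x\<close> switchable whatever its successors look like. The share
  \<open>1 / m\<close> covers both a single agreeing predecessor and \<open>m\<close> predecessors
  with one exception.\<close>

definition favourable :: "nat \<Rightarrow> nat coloring \<Rightarrow> nat \<Rightarrow> color \<Rightarrow> bool" where
  "favourable m C x b \<longleftrightarrow>
     preds m x \<noteq> {} \<and> m * card {y \<in> preds m x. C y \<noteq> b} \<le> card (preds m x)"

lemma layer_eq: "0 < m \<Longrightarrow> {y :: nat. y div m = l} = {l * m..<l * m + m}"
  by (auto simp: div_nat_eqI mult.commute) (metis dividend_less_times_div add.commute)

lemma finite_layer: "0 < m \<Longrightarrow> finite {y :: nat. y div m = l}"
  by (simp add: layer_eq)

lemma card_layer: "0 < m \<Longrightarrow> card {y :: nat. y div m = l} = m"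
  by (simp add: layer_eq)

lemma preds_layer: "preds m x \<subseteq> {y. y div m = x div m - 1}"
  by (auto simp: preds_def)

lemma preds_less: "y \<in> preds m x \<Longrightarrow> y < x"
proof -
  assume "y \<in> preds m x"
  then have "y div m < x div m" by (simp add: preds_def)
  then show "y < x" by (metis div_le_mono leD leI)
qed

lemma finite_preds: "0 < m \<Longrightarrow> finite (preds m x)"
  using preds_layer finite_layer finite_subset by metis

lemma diff_in_preds: "0 < m \<Longrightarrow> m \<le> x \<Longrightarrow> x - m \<in> preds m x"
  by (simp add: preds_def le_div_geq le_mod_geq)

lemma pverts_ladder [simp]: "pverts (ladder m K) = {..<K * m * m}"
  by (simp add: ladder_def)

lemma pair_graph_ladder: "pair_graph (ladder m K)"
proof
  show "finite (parcs (ladder m K))"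
    by (rule finite_subset[of _ "{..<K * m * m} \<times> {..<K * m * m}"]) (auto simp: ladder_def)
  show "symmetric (with_proj (ladder m K))"
    by (auto simp: symmetric_def ladder_def intro!: symI)
qed (auto simp: ladder_def dest: preds_less)

lemma nbhd_ladder:
  assumes "x < K * m * m"
  shows "nbhd (ladder m K) x = preds m x \<union> {y. y < K * m * m \<and> x \<in> preds m y}"
  using assms by (auto simp: nbhd_def ladder_def dest: preds_less)

lemma nbhd_ladder_nonempty:
  assumes "2 \<le> m" "x < K * m * m"
  shows "nbhd (ladder m K) x \<noteq> {}"
proof (cases "m \<le> x")
  case True
  then show ?thesis using diff_in_preds[of m x] nbhd_ladder[OF assms(2)] assms(1) by auto
next
  case False
  have "x + m - m \<in> preds m (x + m)" by (rule diff_in_preds) (use assms in auto)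
  moreover have "x + m < K * m * m"
  proof -
    have "x + m < 2 * m" using False by simp
    also have "\<dots> \<le> m * m" using assms(1) by simp
    also have "\<dots> \<le> K * (m * m)" using assms(2) by (cases K) auto
    finally show ?thesis by (simp add: mult.assoc)
  qed
  ultimately show ?thesis using nbhd_ladder[OF assms(2)] by auto
qed

text \<open>An edge is determined by its larger end \<open>x\<close> and the path of its other end,
  which lies one layer earlier.\<close>

lemma card_edges_ladder: "card (edges (ladder m K)) \<le> K * m * m * m"
proof -
  let ?f = "\<lambda>(x, i). {x, (x div m - 1) * m + i}"
  let ?S = "{..<K * m * m} \<times> {..<m}"
  have *: "{x, y} \<in> ?f ` ?S" if "y \<in> preds m x" "x < K * m * m" for x y
  proof
    have "0 < m" using that(2) by (cases m) auto
    then show "(x, y mod m) \<in> ?S" using that by simp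
    have "y div m = x div m - 1" using that(1) preds_layer by blast
    then show "{x, y} = ?f (x, y mod m)" by simp (metis div_mult_mod_eq)
  qed
  have "edges (ladder m K) \<subseteq> ?f ` ?S"
  proof
    fix e assume "e \<in> edges (ladder m K)"
    then obtain x y where "e = {x, y}" "x < K * m * m" "y < K * m * m" "x \<in> preds m y \<or> y \<in> preds m x"
      by (auto simp: edges_def ladder_def)
    then show "e \<in> ?f ` ?S" using *[of x y] *[of y x] by (auto simp: insert_commute)
  qed
  then have "card (edges (ladder m K)) \<le> card (?f ` ?S)" by (intro card_mono) auto
  also have "\<dots> \<le> card ?S" by (intro card_image_le) auto
  finally show ?thesis by simp
qed

lemma favourable_cong:
  "(\<And>y. y < x \<Longrightarrow> C y = C' y) \<Longrightarrow> favourable m C x b = favourable m C' x b"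
  unfolding favourable_def by (metis (mono_tags, lifting) Collect_cong preds_less)

text \<open>Inside a block the only predecessor is \<open>x - m\<close>.\<close>

lemma favourable_chain:
  assumes "0 < m" "\<not> m dvd x div m" "C (x - m) = b"
  shows "favourable m C x b"
proof -
  have "m \<le> x" using assms(2) by (metis div_less dvd_0_right leI)
  have "y = x - m" if "y \<in> preds m x" for y
  proof -
    have "Suc (y div m) = x div m" "y mod m = x mod m" using that assms(2) by (auto simp: preds_def)
    then have "x = Suc (y div m) * m + y mod m" by (metis div_mult_mod_eq)
    then show ?thesis by simp
  qed
  then have eq: "preds m x = {x - m}" using diff_in_preds[OF assms(1) \<open>m \<le> x\<close>] by blast
  have "{y \<in> preds m x. C y \<noteq> b} = {}" using eq assms(3) by auto
  then show ?thesis unfolding favourable_def by (simp only:) (simp add: eq)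
qed

text \<open>At the start of a block the predecessors are all \<open>m\<close> nodes of the preceding
  layer, and only the one on path \<open>q\<close> may deviate.\<close>

lemma favourable_majority:
  assumes "0 < m" "m dvd x div m" "0 < x div m"
    and "\<And>y. Suc (y div m) = x div m \<Longrightarrow> y mod m \<noteq> q \<Longrightarrow> C y = b"
  shows "favourable m C x b"
proof -
  have eq: "preds m x = {y. y div m = x div m - 1}" using assms(2,3) by (auto simp: preds_def)
  have "{y \<in> preds m x. C y \<noteq> b} \<subseteq> {(x div m - 1) * m + q}"
  proof
    fix y assume y: "y \<in> {y \<in> preds m x. C y \<noteq> b}"
    then have l: "y div m = x div m - 1" using eq by auto
    then have "Suc (y div m) = x div m" using assms(3) by simp
    then have "y mod m = q" using assms(4) y by blast
    then show "y \<in> {(x div m - 1) * m + q}" using l by simp (metis div_mult_mod_eq)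
  qed
  then have "card {y \<in> preds m x. C y \<noteq> b} \<le> card {(x div m - 1) * m + q}" by (intro card_mono) auto
  then have 1: "card {y \<in> preds m x. C y \<noteq> b} \<le> 1" by simp
  have "card (preds m x) = m" using eq card_layer[OF assms(1)] by simp
  then show ?thesis using 1 assms(1) unfolding favourable_def by auto
qed

lemma last_div_mod:
  assumes "0 < m"
  shows "(k * m + (m - 1)) div m = k" "(k * m + (m - 1)) mod m = m - (1 :: nat)"
proof -
  obtain n where "m = Suc n" using assms by (cases m) auto
  then show "(k * m + (m - 1)) div m = k" "(k * m + (m - 1)) mod m = m - 1"
    by (simp_all del: mult_Suc_right)
qed

text \<open>
  The stored flips of a path are kept as close to its last node as possible, at most one at each
  node.
\<close>

definition flip_count :: "nat \<Rightarrow> (nat \<Rightarrow> nat) \<Rightarrow> (nat \<Rightarrow> nat \<Rightarrow> nat) \<Rightarrow> nat \<Rightarrow> nat" where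
  "flip_count m a u x =
     (let k = x div m div m in min (a k) (u k (x mod m) + (m - 1 - x div m mod m)))"

text \<open>The layer number enters the parity so that a node and its predecessor share a color iff
  their counters differ in parity, that is, iff the node is due to flip.\<close>

definition ladder_coloring ::
  "nat \<Rightarrow> nat \<Rightarrow> (nat \<Rightarrow> nat) \<Rightarrow> (nat \<Rightarrow> nat \<Rightarrow> nat) \<Rightarrow> nat coloring" where
  "ladder_coloring m K a u x =
     (if x < K * m * m \<and> even (x div m + flip_count m a u x) then Black else White)"

text \<open>The predecessor stands one position earlier on the path, so one more stored flip fits
  behind it.\<close>

lemma flip_count_diff:
  assumes "\<not> m dvd x div m"
  shows "flip_count m a u (x - m) =
    (let k = x div m div m in min (a k) (u k (x mod m) + (m - x div m mod m)))"
proof -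
  have m: "0 < m" using assms by (cases m) auto
  have "m \<le> x" using assms by (metis div_less dvd_0_right leI)
  then have l: "(x - m) div m = x div m - 1" "(x - m) mod m = x mod m"
    using m by (simp_all add: le_div_geq le_mod_geq)
  obtain t where t: "x div m mod m = Suc t" using assms by (meson dvd_eq_mod_eq_0 not0_implies_Suc)
  then have "x div m - 1 = (x div m div m) * m + t" by (metis add_Suc_right diff_Suc_1 div_mult_mod_eq)
  moreover have "t < m" using t m by (metis Suc_lessD mod_less_divisor)
  ultimately have "(x div m - 1) div m = x div m div m" "(x div m - 1) mod m = t" by simp_all
  then show ?thesis using l t by (simp add: flip_count_def)
qed

section \<open>Simulation of the counters by the minority process\<close>

locale minority_ladder =
  fixes lam eta :: real and m :: nat
  assumes lam: "0 < lam" "lam < 1"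
    and m: "3 \<le> m" "odd m" "4 \<le> m * (1 - lam)"
    and eta: "0 < eta" "4 * m * eta\<^sup>2 \<le> 1 - lam"
begin

abbreviation weight :: "nat \<Rightarrow> real" where
  "weight x \<equiv> eta ^ (x div m)"

abbreviation step :: "nat \<Rightarrow> nat coloring \<Rightarrow> nat coloring \<Rightarrow> bool" where
  "step K \<equiv> sa_step lam (ladder m K) weight"

lemma m_pos: "0 < m"
  using m by simp

text \<open>A node is switchable iff its unlike-colored neighbours carry at most
  \<open>(1 - lam) / 2\<close> of the weight of its neighbourhood. The deviating predecessors carry
  at most \<open>(1 - lam) / 4\<close> of the weight of all predecessors because
  \<open>4 \<le> m * (1 - lam)\<close>; so do the at most \<open>m\<close> successors, each
  \<open>eta\<^sup>2\<close> times as heavy as a predecessor.\<close>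

lemma switchable_favourable:
  assumes "x < K * m * m" "favourable m C x (C x)"
  shows "switchable lam (ladder m K) weight C x"
proof -
  let ?G = "ladder m K"
  let ?U = "preds m x" and ?D = "{y. y < K * m * m \<and> x \<in> preds m y}"
  let ?B = "{y \<in> ?U. C y \<noteq> C x}"
  define a where "a = eta ^ (x div m - 1)"
  have a: "0 < a" using eta by (simp add: a_def)
  have l: "0 < x div m" using assms(2) by (auto simp: favourable_def preds_def)
  have fU: "finite ?U" using finite_preds m_pos by blast
  have wU: "weight y = a" if "y \<in> ?U" for y
  proof -
    have "y div m = x div m - 1" using that preds_layer by blast
    then show ?thesis by (simp add: a_def)
  qed
  have wD: "weight y = eta\<^sup>2 * a" if "y \<in> ?D" for y
  proof -
    have "y div m = Suc (x div m)" using that by (auto simp: preds_def)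
    then have "y div m = 2 + (x div m - 1)" using l by simp
    then show ?thesis by (simp only: a_def power_add)
  qed
  have U: "sum weight ?U = card ?U * a" using wU by simp
  have B: "sum weight ?B = card ?B * a" using wU by simp
  have D: "sum weight ?D = card ?D * (eta\<^sup>2 * a)" using wD by simp
  have cU: "1 \<le> card ?U" using assms(2) fU by (simp add: favourable_def Suc_le_eq card_gt_0_iff)
  have "?D \<subseteq> {y. y div m = Suc (x div m)}" by (auto simp: preds_def)
  then have "card ?D \<le> m" using card_mono[OF finite_layer[OF m_pos]] card_layer[OF m_pos] by metis
  then have "card ?D * (eta\<^sup>2 * a) \<le> m * (eta\<^sup>2 * a)" using eta a by (intro mult_right_mono) auto
  also have "\<dots> = (4 * m * eta\<^sup>2) * (a / 4)" by simp
  also have "\<dots> \<le> (1 - lam) * (a / 4)" using eta a by (intro mult_right_mono) auto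
  also have "\<dots> \<le> (1 - lam) * (card ?U * a / 4)"
    using cU lam a by (intro mult_left_mono) auto
  finally have 1: "sum weight ?D \<le> (1 - lam) * (sum weight ?U / 4)" unfolding D U .
  have "m * card ?B \<le> card ?U" using assms(2) by (simp add: favourable_def)
  then have "real m * card ?B \<le> card ?U" by (metis of_nat_le_iff of_nat_mult)
  then have "(1 - lam) * (m * card ?B) \<le> (1 - lam) * card ?U" using lam by (intro mult_left_mono) auto
  moreover have "4 * real (card ?B) \<le> m * (1 - lam) * card ?B" using m by (intro mult_right_mono) auto
  ultimately have "4 * real (card ?B) \<le> (1 - lam) * card ?U" by (simp add: algebra_simps)
  then have "4 * real (card ?B) * a \<le> (1 - lam) * card ?U * a" using a by (intro mult_right_mono) auto
  then have 2: "sum weight ?B \<le> (1 - lam) * (sum weight ?U / 4)" unfolding B U by simp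
  have N: "nbhd ?G x = ?U \<union> ?D" using nbhd_ladder[OF assms(1)] .
  have fN: "finite (nbhd ?G x)" using N fU by simp
  have "sum weight (nbhd_opp ?G C x) \<le> sum weight (?B \<union> ?D)"
    using fU eta N by (intro sum_mono2) (auto simp: nbhd_opp_def nbhd_same_def)
  also have "\<dots> \<le> sum weight ?B + sum weight ?D"
    using fU eta by (subst sum.union_inter[symmetric]) (auto intro!: sum_nonneg)
  also have "\<dots> \<le> (1 - lam) * (sum weight ?U / 2)" using 1 2 by simp
  also have "\<dots> \<le> (1 - lam) * (sum weight (nbhd ?G x) / 2)"
    using lam fN N eta by (intro mult_left_mono divide_right_mono sum_mono2) auto
  finally have "2 * sum weight (nbhd_opp ?G C x) \<le> (1 - lam) * sum weight (nbhd ?G x)" by simp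
  moreover have "sum weight (nbhd ?G x) = sum weight (nbhd_opp ?G C x) + sum weight (nbhd_same ?G C x)"
    unfolding nbhd_opp_def by (rule sum.subset_diff[OF _ fN]) (auto simp: nbhd_same_def)
  ultimately show ?thesis using assms(1) by (simp add: switchable_def algebra_simps)
qed

lemma step_favourable:
  assumes "x < K * m * m" "favourable m C x (C x)" "C' x \<noteq> C x" "\<And>y. y \<noteq> x \<Longrightarrow> C' y = C y"
  shows "step K C C'"
proof -
  have "C' = C(x := other_color (C x))" using assms(3,4) by (auto simp: fun_eq_iff eq_other_color_iff)
  then show ?thesis using switchable_favourable[OF assms(1,2)] by (auto simp: sa_step_def)
qed

text \<open>
  Predecessors have smaller numbers. So if the nodes are processed in ascending order, a node sees its
  predecessors already recolored, and in descending order not yet recolored.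
\<close>

lemma steps_ascending:
  assumes "\<And>x. C x \<noteq> C' x \<Longrightarrow> x < K * m * m \<and> favourable m C' x (C x)" "C \<noteq> C'"
  shows "(step K)\<^sup>+\<^sup>+ C C'"
proof -
  let ?S = "\<lambda>s y. if y < s then C' y else C y"
  have "(step K)\<^sup>*\<^sup>* C (?S s)" for s
  proof (induction s)
    case (Suc s)
    show ?case
    proof (cases "C s = C' s")
      case True
      then have "?S (Suc s) = ?S s" by (auto simp: fun_eq_iff less_Suc_eq)
      then show ?thesis using Suc by simp
    next
      case False
      have "favourable m (?S s) s (C s)"
        using assms(1)[OF False] favourable_cong[of s "?S s" C'] by simp
      then have "step K (?S s) (?S (Suc s))"
        using assms(1)[OF False] False by (intro step_favourable[where x = s]) auto
      then show ?thesis using Suc by simp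
    qed
  qed simp
  moreover have "?S (K * m * m) = C'"
  proof
    fix x show "?S (K * m * m) x = C' x" using assms(1)[of x] by (cases "C x = C' x") auto
  qed
  ultimately have "(step K)\<^sup>*\<^sup>* C C'" by metis
  then show ?thesis using assms(2) by (metis rtranclpD)
qed

lemma steps_descending:
  assumes "\<And>x. C x \<noteq> C' x \<Longrightarrow> x < K * m * m \<and> favourable m C x (C x)" "C \<noteq> C'"
  shows "(step K)\<^sup>+\<^sup>+ C C'"
proof -
  let ?S = "\<lambda>s y. if y < s then C y else C' y"
  have "(step K)\<^sup>*\<^sup>* (?S s) C'" for s
  proof (induction s)
    case (Suc s)
    show ?case
    proof (cases "C s = C' s")
      case True
      then have "?S (Suc s) = ?S s" by (auto simp: fun_eq_iff less_Suc_eq)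
      then show ?thesis using Suc by simp
    next
      case False
      have "favourable m (?S (Suc s)) s (C s)"
        using assms(1)[OF False] favourable_cong[of s "?S (Suc s)" C] by simp
      then have "step K (?S (Suc s)) (?S s)"
        using assms(1)[OF False] False by (intro step_favourable[where x = s]) auto
      then show ?thesis using Suc by (rule converse_rtranclp_into_rtranclp)
    qed
  qed simp
  moreover have "?S (K * m * m) = C"
  proof
    fix x show "?S (K * m * m) x = C x" using assms(1)[of x] by (cases "C x = C' x") auto
  qed
  ultimately have "(step K)\<^sup>*\<^sup>* C C'" by metis
  then show ?thesis using assms(2) by (metis rtranclpD)
qed

text \<open>On the paths that release a flip, the stored flips move one node forward. Every node
  that changes has a predecessor one flip ahead in the old coloring, hence the descending
  order.\<close>

lemma realize_drain:
  assumes "k < K"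
    and g: "\<And>i. i < m \<Longrightarrow> a k \<le> u k i + (m - 1) \<and> g i \<le> a k \<and> (g i = u k i \<or> g i = Suc (u k i))"
    and i: "i < m" "g i \<noteq> u k i"
  shows "(step K)\<^sup>+\<^sup>+ (ladder_coloring m K a u) (ladder_coloring m K a (u(k := g)))"
    (is "tranclp _ ?C ?C'")
proof (rule steps_descending)
  fix x assume neq: "?C x \<noteq> ?C' x"
  have x: "x < K * m * m" using neq by (auto simp: ladder_coloring_def split: if_splits)
  define t where "t = x div m mod m"
  have k: "x div m div m = k"
    using neq by (auto simp: ladder_coloring_def flip_count_def Let_def split: if_splits)
  have im: "x mod m < m" using m_pos by simp
  have cneq: "min (a k) (u k (x mod m) + (m - 1 - t)) \<noteq> min (a k) (g (x mod m) + (m - 1 - t))"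
    using neq k by (auto simp: ladder_coloring_def flip_count_def Let_def t_def split: if_splits)
  then have lt: "u k (x mod m) + (m - 1 - t) < a k" using g[OF im] by auto
  \<comment> \<open>The capacity bound \<open>a k \<le> u k i + (m - 1)\<close> keeps the first node
    of a path out of the change.\<close>
  then have t: "0 < t" using g[OF im] by (cases t) auto
  have tm: "t < m" using m_pos by (simp add: t_def)
  have nd: "\<not> m dvd x div m" using t by (simp add: t_def dvd_eq_mod_eq_0)
  have le: "u k (x mod m) + (m - t) \<le> a k" using lt tm by linarith
  have "flip_count m a u x = u k (x mod m) + (m - 1 - t)"
    using lt k by (simp add: flip_count_def Let_def t_def[symmetric])
  moreover have "flip_count m a u (x - m) = u k (x mod m) + (m - t)"
    unfolding flip_count_diff[OF nd] using le k by (simp add: Let_def t_def[symmetric])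
  ultimately have "flip_count m a u (x - m) = Suc (flip_count m a u x)" using tm by simp
  moreover have "m \<le> x" using nd by (metis div_less dvd_0_right leI)
  then have "x div m = Suc ((x - m) div m)" using m_pos by (simp add: le_div_geq)
  moreover have "x - m < K * m * m" using x by simp
  ultimately have "?C (x - m) = ?C x" using x by (simp add: ladder_coloring_def)
  then show "x < K * m * m \<and> favourable m ?C x (?C x)"
    using x favourable_chain[OF m_pos nd] by blast
next
  \<comment> \<open>The last node of path \<open>i\<close>, whose flip counter is
    \<open>u k i\<close> itself.\<close>
  define x where "x = (k * m + (m - 1)) * m + i"
  have d: "x div m = k * m + (m - 1)" "x mod m = i" using i by (simp_all add: x_def)
  have d': "x div m div m = k" "x div m mod m = m - 1" unfolding d using last_div_mod[OF m_pos] by blast+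
  have "x < (k * m + (m - 1)) * m + m" using i by (simp add: x_def)
  also have "\<dots> = Suc k * m * m" using m_pos by (cases m) (auto simp: algebra_simps)
  also have "\<dots> \<le> K * m * m" using assms(1) by (intro mult_le_mono1) auto
  finally have x: "x < K * m * m" .
  have "flip_count m a u x = u k i" "flip_count m a (u(k := g)) x = Suc (u k i)"
    using g[OF i(1)] i(2) d d' by (auto simp: flip_count_def)
  then have "?C x \<noteq> ?C' x" using x by (simp add: ladder_coloring_def)
  then show "?C \<noteq> ?C'" by auto
qed

text \<open>The new flip enters at the first layer and travels along each path until it meets the
  stored flips. Each node on the way follows a predecessor that has just flipped, hence the
  ascending order.\<close>

lemma realize_load:
  assumes "Suc k < K" "ready m k a u"
    and room: "\<And>i. i < m \<Longrightarrow> a (Suc k) < u (Suc k) i + (m - 1)"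
  shows "(step K)\<^sup>+\<^sup>+ (ladder_coloring m K a u)
    (ladder_coloring m K (a(Suc k := Suc (a (Suc k)))) u)"
    (is "tranclp _ ?C ?C'")
proof (rule steps_ascending)
  let ?a = "a(Suc k := Suc (a (Suc k)))"
  fix x assume neq: "?C x \<noteq> ?C' x"
  have x: "x < K * m * m" using neq by (auto simp: ladder_coloring_def split: if_splits)
  define t where "t = x div m mod m"
  have tm: "t < m" using m_pos by (simp add: t_def)
  have k: "x div m div m = Suc k"
    using neq by (auto simp: ladder_coloring_def flip_count_def Let_def split: if_splits)
  have "min (a (Suc k)) (u (Suc k) (x mod m) + (m - 1 - t))
      \<noteq> min (Suc (a (Suc k))) (u (Suc k) (x mod m) + (m - 1 - t))"
    using neq k by (auto simp: ladder_coloring_def flip_count_def Let_def t_def split: if_splits)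
  then have lt: "a (Suc k) < u (Suc k) (x mod m) + (m - 1 - t)" by auto
  have cx: "flip_count m a u x = a (Suc k)"
    using lt k by (simp add: flip_count_def Let_def t_def[symmetric])
  have "favourable m ?C' x (?C x)"
  proof (cases "t = 0")
    case False
    then have nd: "\<not> m dvd x div m" by (simp add: t_def dvd_eq_mod_eq_0)
    have "flip_count m ?a u (x - m) = Suc (flip_count m a u x)"
      using flip_count_diff[OF nd, of ?a u] lt tm k cx by (simp add: Let_def t_def[symmetric])
    moreover have "m \<le> x" using nd by (metis div_less dvd_0_right leI)
    then have "x div m = Suc ((x - m) div m)" using m_pos by (simp add: le_div_geq)
    moreover have "x - m < K * m * m" using x by simp
    ultimately have "?C' (x - m) = ?C x" using x by (simp add: ladder_coloring_def)
    then show ?thesis using favourable_chain[OF m_pos nd] by blast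
  next
    case True
    then have d: "m dvd x div m" by (simp add: t_def dvd_eq_mod_eq_0)
    have l: "x div m = Suc k * m" using True k by (metis add.right_neutral div_mult_mod_eq t_def)
    obtain q where q: "\<And>i. i < m \<Longrightarrow> i \<noteq> q \<Longrightarrow> odd (u k i + a (Suc k))"
      and le: "\<And>i. i < m \<Longrightarrow> u k i \<le> a k"
      using assms(2) by (auto simp: ready_def)
    show ?thesis
    proof (rule favourable_majority[OF m_pos d])
      show "0 < x div m" using l m_pos by simp
      fix y assume y: "Suc (y div m) = x div m" "y mod m \<noteq> q"
      have "y div m = k * m + (m - 1)" using y(1) l m_pos by simp
      then have yk: "y div m div m = k" "y div m mod m = m - 1" using last_div_mod[OF m_pos] by metis+
      have ym: "y mod m < m" using m_pos by simp
      \<comment> \<open>At a last node the bound \<open>u k i \<le> a k\<close> from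
        \<open>ready\<close> lets the minimum in \<open>flip_count\<close> be
        \<open>u k i\<close>.\<close>
      have "flip_count m ?a u y = u k (y mod m)" using yk le[OF ym] by (simp add: flip_count_def)
      moreover have "y < K * m * m"
      proof -
        have "y div m < x div m" using y(1) by simp
        then have "y < x" by (metis div_le_mono leD leI)
        then show ?thesis using x by simp
      qed
      ultimately show "?C' y = ?C x"
        using q[OF ym y(2)] y(1)[symmetric] cx x by (simp add: ladder_coloring_def)
    qed
  qed
  then show "x < K * m * m \<and> favourable m ?C' x (?C x)" using x by simp
next
  \<comment> \<open>The first node of path \<open>0\<close> in block \<open>Suc k\<close>; it flips
    since \<open>room\<close> leaves space on its path.\<close>
  define x where "x = Suc k * m * m"
  have d: "x div m = Suc k * m" "x mod m = 0" "x div m div m = Suc k" "x div m mod m = 0"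
    using m_pos by (simp_all add: x_def del: mult_Suc)
  have x: "x < K * m * m" using assms(1) m_pos by (simp add: x_def del: mult_Suc)
  have "?C x \<noteq> ?C' x"
    using room[OF m_pos] x d(2-) by (simp add: ladder_coloring_def flip_count_def)
  then show "?C \<noteq> ?C'" by auto
qed

lemma realize_counter_step:
  assumes "counter_step m K (a, u) (a', u')"
  shows "(step K)\<^sup>+\<^sup>+ (ladder_coloring m K a u) (ladder_coloring m K a' u')"
  using assms by cases (use realize_drain realize_load in \<open>simp_all\<close>)

lemma realize_counter_steps:
  assumes "(counter_step m K)\<^sup>+\<^sup>+ (a, u) (a', u')"
  shows "(step K)\<^sup>+\<^sup>+ (ladder_coloring m K a u) (ladder_coloring m K a' u')"
  using assms
proof (induction "(a', u')" arbitrary: a' u' rule: tranclp_induct)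
  case base
  then show ?case using realize_counter_step by blast
next
  case (step y)
  obtain a1 u1 where y: "y = (a1, u1)" by force
  show ?case using step y realize_counter_step tranclp_trans by metis
qed

text \<open>With \<open>K\<close> blocks no node belongs to block \<open>K\<close>, so its counter
  is fictitious.\<close>

lemma ladder_coloring_upd:
  "ladder_coloring m K (a(K := b)) u = ladder_coloring m K a u"
proof
  fix x
  have "x div m div m \<noteq> K" if "x < K * m * m"
    using that by (metis div_mult2_eq less_irrefl less_mult_imp_div_less mult.assoc)
  then show "ladder_coloring m K (a(K := b)) u x = ladder_coloring m K a u x"
    by (auto simp: ladder_coloring_def flip_count_def Let_def)
qed

text \<open>The \<open>n\<close> flips of the fictitious block \<open>K\<close> are not steps of the
  process, but each is preceded by a counter step inside the graph and so by at least one actual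
  switch.\<close>

lemma available_steps:
  assumes "available m K n (a, u)"
  shows "\<exists>N\<ge>n. \<exists>C. (step K ^^ N) (ladder_coloring m K a u) C"
  using assms
proof (induction K n "(a, u)" arbitrary: a u rule: available.induct)
  case (zero K)
  show ?case by (intro exI[of _ 0]) auto
next
  case (Suc K a u a' u' n)
  obtain N C where N: "n \<le> N" "(step (Suc K) ^^ N) (ladder_coloring m (Suc K) a' u') C"
    using Suc.hyps(4) by (auto simp: ladder_coloring_upd)
  obtain p where p: "0 < p"
    "(step (Suc K) ^^ p) (ladder_coloring m (Suc K) a u) (ladder_coloring m (Suc K) a' u')"
    using realize_counter_steps[OF Suc.hyps(1)] by (auto simp: tranclp_power)
  have "(step (Suc K) ^^ (p + N)) (ladder_coloring m (Suc K) a u) C"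
    using p(2) N(2) by (auto simp: relpowp_add)
  then show ?case using p(1) N(1) by (intro exI[of _ "p + N"]) auto
qed

lemma alternations_steps:
  "\<exists>N\<ge>alternations m K. \<exists>C. (step K ^^ N) (ladder_coloring m K (\<lambda>_. m - 1) (\<lambda>_ _. 0)) C"
  by (rule available_steps[OF available_alternations[OF m(1,2)]])

lemma stabilization_time_ladder:
  "\<exists>T. stabilization_time_SA lam (ladder m K) weight (ladder_coloring m K (\<lambda>_. m - 1) (\<lambda>_ _. 0)) = enat T
     \<and> alternations m K \<le> T \<and> T \<le> 2 ^ (K * m * m)"
proof -
  let ?C = "ladder_coloring m K (\<lambda>_. m - 1) (\<lambda>_ _. 0)"
  obtain N C where N: "alternations m K \<le> N" "(step K ^^ N) ?C C" using alternations_steps by blast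
  have "\<exists>T. stabilization_time_SA lam (ladder m K) weight ?C = enat T \<and> N \<le> T
      \<and> T \<le> 2 ^ card (pverts (ladder m K))"
    by (rule stabilization_time_SA_bounds[where lam = lam and w = weight, OF pair_graph_ladder _ _ _ N(2)])
       (use eta lam m nbhd_ladder_nonempty in auto)
  then show ?thesis using N(1) by (auto intro: order_trans)
qed

end

section \<open>Exponential growth of the number of flips\<close>

lemma alternations_lower_bound:
  assumes "3 \<le> m"
  shows "((real m + 1) / (real m - 1)) ^ Suc k \<le> real (alternations m (Suc k))"
proof (induction k)
  case 0
  have "(real m + 1) / (real m - 1) \<le> real m + 1" using assms by (simp add: divide_simps)
  then show ?case by simp
next
  case (Suc k)
  define n where "n = alternations m (Suc k)"
  let ?r = "(real m + 1) / (real m - 1)"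
  have rec: "alternations m (Suc (Suc k)) = Suc m * Suc (n div (m - 1))"
    unfolding n_def by (rule alternations.simps)
  \<comment> \<open>Rounding costs nothing, since \<open>Suc (n div (m - 1))\<close> exceeds
    \<open>n / (m - 1)\<close>; each level gains the full factor \<open>?r\<close>.\<close>
  have "n < (m - 1) * Suc (n div (m - 1))"
    using dividend_less_times_div[of "m - 1" n] assms by simp
  then have "real n \<le> real ((m - 1) * Suc (n div (m - 1)))" by (intro of_nat_mono) simp
  also have "\<dots> = (real m - 1) * real (Suc (n div (m - 1)))"
    using assms by (simp only: of_nat_mult) (simp add: of_nat_diff)
  finally have "?r * real n \<le> ?r * ((real m - 1) * real (Suc (n div (m - 1))))"
    using assms by (intro mult_left_mono) auto
  also have "\<dots> = real (alternations m (Suc (Suc k)))"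
    unfolding rec of_nat_mult using assms by simp
  finally have "?r * real n \<le> real (alternations m (Suc (Suc k)))" .
  moreover have "?r ^ Suc (Suc k) \<le> ?r * real n"
    unfolding power_Suc[of ?r "Suc k"] n_def using Suc assms by (intro mult_left_mono) auto
  ultimately show ?case by linarith
qed

theorem theorem1:
  fixes lam :: real
  assumes "0 < lam" and "lam < 1"
  shows "\<exists>(G :: nat \<Rightarrow> nat pair_pre_digraph) (w :: nat \<Rightarrow> nat \<Rightarrow> real) (C0 :: nat \<Rightarrow> nat coloring).
    (\<forall>k. pair_graph (G k)) \<and>
    (\<forall>k. \<forall>v \<in> pverts (G k). w k v > 0) \<and>
    filterlim (\<lambda>k. card (pverts (G k))) at_top sequentially \<and>
    (\<lambda>k. real (card (edges (G k)))) \<in> O(\<lambda>k. real (card (pverts (G k)))) \<and>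
    (\<exists>(T :: nat \<Rightarrow> nat) (f :: nat \<Rightarrow> real).
       (\<forall>k. stabilization_time_SA lam (G k) (w k) (C0 k) = enat (T k)) \<and>
       (\<forall>k. real (T k) = 2 powr f k) \<and>
       f \<in> \<Theta>(\<lambda>k. real (card (pverts (G k)))))"
proof -
  obtain j :: nat where j: "4 / (1 - lam) \<le> real j" using real_arch_simple by blast
  \<comment> \<open>Odd, at least \<open>3\<close> and at least
    \<open>4 / (1 - lam)\<close>.\<close>
  define m where "m = 2 * j + 3"
  \<comment> \<open>One factor \<open>eta\<close> cancels \<open>4 * m\<close> in
    \<open>4 * m * eta\<^sup>2\<close>, which leaves \<open>(1 - lam) * eta\<close>.\<close>
  define eta where "eta = (1 - lam) / (4 * m)"
  have m3: "3 \<le> m" and odd_m: "odd m" by (simp_all add: m_def)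
  have "4 / (1 - lam) \<le> real m" using j by (simp add: m_def)
  then have m4: "4 \<le> m * (1 - lam)" using assms by (simp add: divide_le_eq)
  have eta0: "0 < eta" using assms m3 by (simp add: eta_def)
  have "4 * m * eta\<^sup>2 = (1 - lam) * eta" using m3 by (simp add: eta_def power2_eq_square)
  also have "\<dots> \<le> (1 - lam) * 1"
    using assms m3 by (intro mult_left_mono) (auto simp: eta_def divide_le_eq)
  finally have eta1: "4 * m * eta\<^sup>2 \<le> 1 - lam" by simp
  interpret minority_ladder lam eta m
    by unfold_locales (use assms m3 odd_m m4 eta0 eta1 in simp_all)
  \<comment> \<open>At least one block, so that the lower bound for the time is positive and its
    logarithm makes sense.\<close>
  define G where "G k = ladder m (Suc k)" for k
  define C0 where "C0 k = ladder_coloring m (Suc k) (\<lambda>_. m - 1) (\<lambda>_ _. 0)" for k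
  have card: "card (pverts (G k)) = Suc k * m * m" for k by (simp add: G_def)
  obtain T where T: "\<And>k. stabilization_time_SA lam (G k) weight (C0 k) = enat (T k)"
    and T_ge: "\<And>k. alternations m (Suc k) \<le> T k" and T_le: "\<And>k. T k \<le> 2 ^ (Suc k * m * m)"
    using stabilization_time_ladder unfolding G_def C0_def by metis
  define r where "r = (real m + 1) / (real m - 1)"
  have r1: "1 < r" using m3 by (simp add: r_def divide_simps)
  define f where "f k = log 2 (real (T k))" for k
  have low: "r ^ Suc k \<le> real (T k)" for k
    using alternations_lower_bound[OF m3, of k] T_ge[of k] unfolding r_def
    by (meson of_nat_le_iff order_trans)
  have T_pos: "0 < real (T k)" for k
    using low[of k] r1 by (meson less_le_trans less_trans zero_less_one zero_less_power)
  have f_ge: "real (Suc k) * log 2 r \<le> f k" for k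
  proof -
    have "real (Suc k) * log 2 r = log 2 (r ^ Suc k)" using r1 by (subst log_nat_power) auto
    also have "\<dots> \<le> f k" unfolding f_def using low[of k] T_pos[of k] r1 by (subst log_le_cancel_iff) auto
    finally show ?thesis .
  qed
  have f_le: "f k \<le> real (Suc k * m * m)" for k
  proof -
    have "real (T k) \<le> 2 ^ (Suc k * m * m)" using T_le[of k] by (metis of_nat_le_iff of_nat_numeral of_nat_power)
    then have "f k \<le> log 2 (2 ^ (Suc k * m * m))"
      unfolding f_def using T_pos[of k] by (subst log_le_cancel_iff) auto
    then show ?thesis by (simp add: log_nat_power del: mult_Suc)
  qed
  have lr: "0 < log 2 r" using r1 by simp
  have "f \<in> \<Theta>(\<lambda>k. real (card (pverts (G k))))"
  \<comment> \<open>Each block has \<open>m * m\<close> nodes and contributes at least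
    \<open>log 2 r\<close> to the exponent.\<close>
  proof (rule bigthetaI'[where ?c1.0 = "log 2 r / (m * m)" and ?c2.0 = 1])
    show "0 < log 2 r / real (m * m)" using lr m3 by simp
    have "0 \<le> f k" for k using f_ge[of k] lr by (meson less_imp_le mult_nonneg_nonneg of_nat_0_le_iff order_trans)
    moreover have "log 2 r / real (m * m) * real (Suc k * m * m) = real (Suc k) * log 2 r" for k
      using m3 by (simp add: field_simps)
    ultimately show "\<forall>\<^sub>F k in sequentially.
        log 2 r / real (m * m) * norm (real (card (pverts (G k)))) \<le> norm (f k) \<and>
        norm (f k) \<le> 1 * norm (real (card (pverts (G k))))"
      unfolding card using f_ge f_le by (intro always_eventually allI) (simp del: mult_Suc of_nat_Suc of_nat_mult)
  qed simp
  moreover have "real (T k) = 2 powr f k" for k using T_pos[of k] by (simp add: f_def)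
  moreover have "(\<lambda>k. real (card (edges (G k)))) \<in> O(\<lambda>k. real (card (pverts (G k))))"
  proof (rule bigoI[where c = "real m"], intro always_eventually allI)
    fix k
    have "real (card (edges (G k))) \<le> real (Suc k * m * m * m)"
      unfolding G_def by (intro of_nat_mono card_edges_ladder)
    then show "norm (real (card (edges (G k)))) \<le> real m * norm (real (card (pverts (G k))))"
      unfolding card by (simp add: algebra_simps)
  qed
  moreover have "filterlim (\<lambda>k. card (pverts (G k))) at_top sequentially"
  proof (rule filterlim_at_top_mono[OF filterlim_Suc], intro always_eventually allI)
    fix k
    have "Suc k * 1 * 1 \<le> Suc k * m * m" using m3 by (intro mult_le_mono) auto
    then show "Suc k \<le> card (pverts (G k))" unfolding card by simp
  qed
  moreover have "pair_graph (G k)" for k by (simp add: G_def pair_graph_ladder)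
  moreover have "\<forall>v\<in>pverts (G k). 0 < weight v" for k using eta0 by simp
  ultimately show ?thesis
    using T by (intro exI[of _ G] exI[of _ "\<lambda>_. weight"] exI[of _ C0] conjI exI[of _ T] exI[of _ f]) auto
qed

end
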